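(* For all integers $b$, $m\ge 0$ and $k\ge 1$, and for any choice of the integers $c_b(p_ip_j)$ as described in the context, $$\sum_{\substack{b<a\le b+m\\ \omega_k(a)>0}}\bigl(\omega_k(a)-1\bigr)=\sum_{j=2}^{k}F_{b,m}(2p_j)+\sum_{i=2}^{k-1}\sum_{j=i+1}^{k}\varphi\bigl(c_b(p_ip_j),\,F_{b,m}(p_ip_j),\,i-1\bigr).$$
   Context: $p_i$ denotes the $i$-th prime ($p_1=2$) and $P_k=p_1\cdots p_k$. For an integer $a$, $\omega_k(a)$ is the number of indices $i\le k$ with $p_i\mid a$. For integers $b$, $m\ge0$, $d\ge1$, $F_{b,m}(d)$ is the number of integers $a$ with $b<a\le b+m$ and $d\mid a$. For integers $c$, $n\ge 0$, $t\ge1$, $\varphi(c,n,t)$ is the number of integers $a$ with $c<a\le c+n$ and $\gcd(a,P_t)=1$ (so $\varphi(c,0,t)=0$). For $2\le i<j$ and $d=p_ip_j$ (with $b,m$ fixed): if $F_{b,m}(d)\ge1$, let $y+d$ be the smallest integer in $\{b+1,\dots,b+m\}$ divisible by $d$; then $c_b(d)$ denotes an integer such that $\gcd(c_b(d)+x,P_{i-1})=\gcd(y+xd,P_{i-1})$ for all integers $x$ (such an integer exists). If $F_{b,m}(d)=0$, $c_b(d)$ is an arbitrary integer (the corresponding term is $0$). *)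

theory Defs
  imports "HOL-Library.Infinite_Set" "HOL-Computational_Algebra.Primes"
begin

text \<open>Indices start at 1, so that the first prime is \<open>nth_prime 1 = 2\<close>; the value at 0 is junk.\<close>

definition nth_prime :: "nat \<Rightarrow> nat" where
  "nth_prime i = enumerate {p. prime p} (i - 1)"

definition primorial :: "nat \<Rightarrow> nat" where
  "primorial k = (\<Prod>i=1..k. nth_prime i)"

definition omega_upto :: "nat \<Rightarrow> int \<Rightarrow> nat" where
  "omega_upto k a = card {i \<in> {1..k}. int (nth_prime i) dvd a}"

definition multiples :: "int \<Rightarrow> nat \<Rightarrow> nat \<Rightarrow> int set" where
  "multiples b m d = {a \<in> {b<..b + int m}. int d dvd a}"

definition F :: "int \<Rightarrow> nat \<Rightarrow> nat \<Rightarrow> nat" where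
  "F b m d = card (multiples b m d)"

definition phi :: "int \<Rightarrow> nat \<Rightarrow> nat \<Rightarrow> nat" where
  "phi c n t = card {a \<in> {c<..c + int n}. gcd a (int (primorial t)) = 1}"

text \<open>\<open>admissible_shift b m i j c\<close> says that the integer \<open>c\<close> is a legitimate choice of
  \<open>c\<^sub>b(d)\<close> for \<open>d = p\<^sub>i p\<^sub>j\<close>; every integer is one when the interval contains no multiple of \<open>d\<close>.\<close>

definition admissible_shift :: "int \<Rightarrow> nat \<Rightarrow> nat \<Rightarrow> nat \<Rightarrow> int \<Rightarrow> bool" where
  "admissible_shift b m i j c \<longleftrightarrow>
    (let d = nth_prime i * nth_prime j in
      F b m d \<ge> 1 \<longrightarrow>
      (let y = Min (multiples b m d) - int d in
        \<forall>x::int. gcd (c + x) (int (primorial (i - 1))) = gcd (y + x * int d) (int (primorial (i - 1)))))"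

end

theory Submission
  imports Defs
begin

text \<open>If \<open>p\<^sub>i\<close> is the least prime among \<open>p\<^sub>1, \<dots>, p\<^sub>k\<close> dividing \<open>a\<close>, then \<open>\<omega>\<^sub>k(a) - 1\<close> counts the
  indices \<open>j > i\<close> with \<open>p\<^sub>j\<close> dividing \<open>a\<close>. Hence the left-hand side counts the triples \<open>(a, i, j)\<close>
  with \<open>i < j\<close>, \<open>p\<^sub>i p\<^sub>j\<close> dividing \<open>a\<close> and \<open>a\<close> coprime to \<open>P\<^bsub>i-1\<^esub>\<close>. For fixed \<open>i < j\<close> and \<open>d = p\<^sub>i p\<^sub>j\<close>
  the multiples of \<open>d\<close> in the interval are \<open>y + x d\<close> with \<open>1 \<le> x \<le> F(d)\<close>, and the defining property of
  the shift \<open>c(d)\<close> turns the coprimality of \<open>y + x d\<close> into that of \<open>c(d) + x\<close>. For \<open>i = 1\<close> the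
  coprimality condition is void.\<close>

lemma prime_nth_prime: "prime (nth_prime i)"
  using enumerate_in_set[OF primes_infinite] unfolding nth_prime_def by blast

lemma nth_prime_less: "1 \<le> i \<Longrightarrow> i < j \<Longrightarrow> nth_prime i < nth_prime j"
  unfolding nth_prime_def by (intro enumerate_mono primes_infinite) auto

lemma nth_prime_1: "nth_prime 1 = 2"
  unfolding nth_prime_def
  by (simp add: enumerate_0) (intro Least_equality two_is_prime_nat prime_ge_2_nat)

lemma nth_prime_mult_dvd_iff:
  assumes "1 \<le> i" "i < j"
  shows "int (nth_prime i * nth_prime j) dvd a \<longleftrightarrow>
    int (nth_prime i) dvd a \<and> int (nth_prime j) dvd a"
proof -
  have "coprime (nth_prime i) (nth_prime j)"
    using nth_prime_less[OF assms] by (intro primes_coprime prime_nth_prime) auto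
  then have "coprime (int (nth_prime i)) (int (nth_prime j))"
    by simp
  then show ?thesis
    by (auto intro: divides_mult dvd_mult_left dvd_mult_right)
qed

text \<open>Turns coprimality to \<open>primorial t\<close> into a condition on prime indices, so
  that it can say that no index below a given one divides.\<close>

lemma gcd_primorial_eq_1_iff:
  "gcd a (int (primorial t)) = 1 \<longleftrightarrow> (\<forall>i\<in>{1..t}. \<not> int (nth_prime i) dvd a)"
proof
  assume g: "gcd a (int (primorial t)) = 1"
  show "\<forall>i\<in>{1..t}. \<not> int (nth_prime i) dvd a"
  proof (intro ballI notI)
    fix i assume i: "i \<in> {1..t}" "int (nth_prime i) dvd a"
    then have "int (nth_prime i) dvd int (primorial t)"
      unfolding primorial_def by (intro iffD2[OF int_dvd_int_iff] dvd_prodI) auto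
    with i(2) have "int (nth_prime i) dvd gcd a (int (primorial t))"
      by simp
    then have "nth_prime i = 1"
      by (simp add: g)
    then show False
      using prime_nth_prime[of i] by simp
  qed
next
  assume nd: "\<forall>i\<in>{1..t}. \<not> int (nth_prime i) dvd a"
  have "coprime a (\<Prod>i=1..t. int (nth_prime i))"
  proof (rule prod_coprime_right)
    fix i assume "i \<in> {1..t}"
    then have "coprime (int (nth_prime i)) a"
      using nd prime_nth_prime by (intro prime_imp_coprime) auto
    then show "coprime a (int (nth_prime i))"
      by (simp add: coprime_commute)
  qed
  then show "gcd a (int (primorial t)) = 1"
    by (simp add: primorial_def)
qed

lemma finite_multiples: "finite (multiples b m d)"
  unfolding multiples_def by (rule finite_subset[of _ "{b<..b + int m}"]) auto

text \<open>The multiples of \<open>d\<close> in the interval are consecutive terms of a progression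
  with step \<open>d\<close>, so the least one and their number determine them all.\<close>

lemma multiples_eq_image:
  assumes "0 < d" "1 \<le> F b m d"
  shows "multiples b m d = (\<lambda>x. Min (multiples b m d) - int d + x * int d) ` {0<..int (F b m d)}"
proof -
  define M where "M = multiples b m d"
  define y where "y = Min M - int d"
  \<comment> \<open>The largest \<open>x\<close> with \<open>y + x * int d\<close> still at most
    \<open>b + int m\<close>; that it equals \<open>F b m d\<close> follows only at the end, by
    counting.\<close>
  define N where "N = (b + int m - y) div int d"
  have fin: "finite M"
    by (simp add: M_def finite_multiples)
  have "M \<noteq> {}"
    using assms(2) by (auto simp: F_def M_def)
  then have "Min M \<in> M"
    using fin by simp
  then have min: "b < y + int d" "y + int d \<le> b + int m" "int d dvd y"
    by (auto simp: M_def y_def multiples_def)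
  have M: "M = (\<lambda>x. y + x * int d) ` {0<..N}"
  proof (intro equalityI subsetI)
    fix a assume a: "a \<in> M"
    then have "Min M \<le> a" "int d dvd a - y"
      using fin min by (auto simp: M_def multiples_def)
    then obtain x where "a - y = int d * x"
      by blast
    then have x: "a = y + x * int d"
      by (simp add: algebra_simps)
    have "1 * int d \<le> x * int d"
      using \<open>Min M \<le> a\<close> x by (simp add: y_def)
    then have "1 \<le> x"
      using assms(1) by (simp only: mult_le_cancel_right)
    moreover have "x * int d \<le> b + int m - y"
      using a x by (auto simp: M_def multiples_def)
    then have "x \<le> N"
      using assms(1) zdiv_mono1[of "x * int d" _ "int d"] by (simp add: N_def)
    ultimately show "a \<in> (\<lambda>x. y + x * int d) ` {0<..N}"
      using x by auto
  next
    fix a assume "a \<in> (\<lambda>x. y + x * int d) ` {0<..N}"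
    then obtain x where x: "a = y + x * int d" "x \<in> {0<..N}"
      by (rule imageE)
    have "1 * int d \<le> x * int d" "x * int d \<le> N * int d"
      using x(2) by (intro mult_right_mono; simp)+
    moreover have "N * int d \<le> b + int m - y"
      using assms(1) pos_mod_sign[of "int d" "b + int m - y"]
        div_mult_mod_eq[of "b + int m - y" "int d"] unfolding N_def by linarith
    ultimately have "b < a" "a \<le> b + int m"
      using x(1) min(1) by linarith+
    then show "a \<in> M"
      using x(1) min(3) by (simp add: M_def multiples_def)
  qed
  have "inj_on (\<lambda>x. y + x * int d) {0<..N}"
    using assms(1) by (auto intro: inj_onI)
  then have "card M = nat N"
    by (simp add: M card_image)
  \<comment> \<open>Since \<open>F b m d\<close> is positive, \<open>nat\<close> has not truncated a
    negative \<open>N\<close>.\<close>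
  then have "int (F b m d) = N"
    using assms(2) by (auto simp: F_def M_def)
  then show ?thesis
    using M by (simp add: M_def y_def)
qed

lemma phi_admissible_shift:
  assumes "admissible_shift b m i j c"
  shows "phi c (F b m (nth_prime i * nth_prime j)) (i - 1) =
    card {a \<in> multiples b m (nth_prime i * nth_prime j). gcd a (int (primorial (i - 1))) = 1}"
\<comment> \<open>With no multiples the shift is arbitrary, but the window
  \<open>{c<..c + 0}\<close> is empty, so both counts vanish.\<close>
proof (cases "F b m (nth_prime i * nth_prime j) = 0")
  case True
  then have "multiples b m (nth_prime i * nth_prime j) = {}"
    by (simp add: F_def finite_multiples)
  then show ?thesis
    using True by (simp add: phi_def)
next
  case False
  define d where "d = nth_prime i * nth_prime j"
  define n where "n = F b m d"
  define y where "y = Min (multiples b m d) - int d"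
  define P where "P = int (primorial (i - 1))"
  have "d > 0"
    by (simp add: d_def prime_gt_0_nat prime_nth_prime)
  have "n \<ge> 1"
    using False by (simp add: n_def d_def)
  have shift: "gcd (c + x) P = gcd (y + x * int d) P" for x
    using assms \<open>n \<ge> 1\<close>
    unfolding admissible_shift_def Let_def d_def[symmetric] n_def[symmetric] y_def[symmetric]
      P_def[symmetric] by blast
  \<comment> \<open>A common parameter set: both counted sets are injective images of
    \<open>X\<close>, one under translation by \<open>c\<close>, the other along the
    progression.\<close>
  define X where "X = {x \<in> {0<..int n}. gcd (c + x) P = 1}"
  have "{a \<in> {c<..c + int n}. gcd a P = 1} = (\<lambda>x. c + x) ` X"
  proof (intro equalityI subsetI)
    fix a assume "a \<in> {a \<in> {c<..c + int n}. gcd a P = 1}"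
    then have "a - c \<in> X" "a = c + (a - c)"
      by (auto simp: X_def)
    then show "a \<in> (\<lambda>x. c + x) ` X"
      by blast
  qed (auto simp: X_def)
  then have "phi c n (i - 1) = card X"
    by (simp add: phi_def P_def card_image)
  moreover have "multiples b m d = (\<lambda>x. y + x * int d) ` {0<..int n}"
    using \<open>d > 0\<close> \<open>n \<ge> 1\<close> unfolding n_def y_def by (rule multiples_eq_image)
  then have "{a \<in> multiples b m d. gcd a P = 1} = (\<lambda>x. y + x * int d) ` X"
    by (simp only: X_def shift Compr_image_eq)
  moreover have "inj_on (\<lambda>x. y + x * int d) X"
    using \<open>d > 0\<close> by (auto intro: inj_onI)
  ultimately show ?thesis
    by (simp add: card_image n_def d_def P_def)
qed

text \<open>Only \<open>i = Min S\<close> passes the test, and then \<open>j\<close> runs over the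
  other members of \<open>S\<close>. For empty \<open>S\<close> both sides are 0 by truncated
  subtraction.\<close>

lemma sum_pairs_least_member:
  fixes S :: "nat set"
  assumes "S \<subseteq> {1..k}"
  shows "(\<Sum>i=1..k. \<Sum>j=i+1..k. if i \<in> S \<and> j \<in> S \<and> (\<forall>l\<in>{1..i-1}. l \<notin> S) then 1 else 0) = card S - 1"
proof (cases "S = {}")
  case False
  have fin: "finite S"
    using assms finite_subset by blast
  define s where "s = Min S"
  have s: "s \<in> S" "\<And>l. l \<in> S \<Longrightarrow> s \<le> l"
    using False fin by (auto simp: s_def)
  have least: "i \<in> S \<and> (\<forall>l\<in>{1..i-1}. l \<notin> S) \<longleftrightarrow> i = s" for i
  proof
    assume i: "i \<in> S \<and> (\<forall>l\<in>{1..i-1}. l \<notin> S)"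
    have "1 \<le> s"
      using s(1) assms by auto
    then show "i = s"
      using i s(1) s(2)[of i] by (cases "s \<le> i - 1") auto
  next
    assume "i = s"
    then show "i \<in> S \<and> (\<forall>l\<in>{1..i-1}. l \<notin> S)"
      using s by fastforce
  qed
  have "(\<Sum>i=1..k. \<Sum>j=i+1..k. if i \<in> S \<and> j \<in> S \<and> (\<forall>l\<in>{1..i-1}. l \<notin> S) then 1 else 0) =
        (\<Sum>i=1..k. if i = s then (\<Sum>j=s+1..k. if j \<in> S then 1 else 0) else 0 :: nat)"
    using least by (intro sum.cong refl) (auto intro!: sum.cong sum.neutral)
  also have "\<dots> = (\<Sum>j=s+1..k. if j \<in> S then 1 else 0)"
    using s(1) assms by auto
  also have "\<dots> = card ({s+1..k} \<inter> S)"
    by (simp add: sum.If_cases)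
  also have "{s+1..k} \<inter> S = S - {s}"
  proof (intro equalityI subsetI)
    fix j assume "j \<in> S - {s}"
    then show "j \<in> {s+1..k} \<inter> S"
      using s(2)[of j] assms by auto
  qed auto
  also have "card \<dots> = card S - 1"
    using s(1) by simp
  finally show ?thesis .
qed simp

theorem theorem3p3:
  fixes b :: int and m k :: nat and c :: "nat \<Rightarrow> int"
  assumes "k \<ge> 1"
    and "\<And>i j. 2 \<le> i \<Longrightarrow> i < j \<Longrightarrow> j \<le> k \<Longrightarrow>
           admissible_shift b m i j (c (nth_prime i * nth_prime j))"
  shows "(\<Sum>a | a \<in> {b<..b + int m} \<and> omega_upto k a > 0. int (omega_upto k a) - 1) =
         int ((\<Sum>j=2..k. F b m (2 * nth_prime j)) +
              (\<Sum>i=2..k - 1. \<Sum>j=i + 1..k.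
                 phi (c (nth_prime i * nth_prime j)) (F b m (nth_prime i * nth_prime j)) (i - 1)))"
proof -
  define I where "I = {b<..b + int m}"
  define G where "G i j = card {a \<in> multiples b m (nth_prime i * nth_prime j).
    gcd a (int (primorial (i - 1))) = 1}" for i j
  define D where "D a = {i \<in> {1..k}. int (nth_prime i) dvd a}" for a
  define T where "T i j a = (if i \<in> D a \<and> j \<in> D a \<and> (\<forall>l\<in>{1..i-1}. l \<notin> D a) then 1 else 0 :: nat)"
    for i j a
  have "finite I"
    by (simp add: I_def)
  have omega: "omega_upto k a = card (D a)" for a
    by (simp add: omega_upto_def D_def)
  have "(\<Sum>a | a \<in> I \<and> omega_upto k a > 0. int (omega_upto k a) - 1) =
        (\<Sum>a | a \<in> I \<and> omega_upto k a > 0. int (omega_upto k a - 1))"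
    by (intro sum.cong) auto
  \<comment> \<open>With subtraction now in \<open>nat\<close>, elements with
    \<open>omega_upto k a = 0\<close> contribute 0 and may be added.\<close>
  also have "\<dots> = (\<Sum>a\<in>I. int (omega_upto k a - 1))"
    using \<open>finite I\<close> by (intro sum.mono_neutral_left) auto
  also have "\<dots> = int (\<Sum>a\<in>I. \<Sum>i=1..k. \<Sum>j=i+1..k. T i j a)"
  proof -
    have "omega_upto k a - 1 = (\<Sum>i=1..k. \<Sum>j=i+1..k. T i j a)" for a
      unfolding omega T_def by (rule sum_pairs_least_member[symmetric]) (auto simp: D_def)
    then show ?thesis
      by simp
  qed
  also have "(\<Sum>a\<in>I. \<Sum>i=1..k. \<Sum>j=i+1..k. T i j a) = (\<Sum>i=1..k. \<Sum>j=i+1..k. \<Sum>a\<in>I. T i j a)"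
    by (subst sum.swap, intro sum.cong refl, rule sum.swap)
  also have "\<dots> = (\<Sum>i=1..k. \<Sum>j=i+1..k. G i j)"
  proof (intro sum.cong refl)
    fix i j assume ij: "i \<in> {1..k}" "j \<in> {i+1..k}"
    \<comment> \<open>As \<open>i\<close> and \<open>j\<close> are at most \<open>k\<close>, all
      indices tested here lie in \<open>{1..k}\<close>, so the bound built into \<open>D\<close>
      loses nothing.\<close>
    have "{a \<in> I. i \<in> D a \<and> j \<in> D a \<and> (\<forall>l\<in>{1..i-1}. l \<notin> D a)} =
      {a \<in> multiples b m (nth_prime i * nth_prime j). gcd a (int (primorial (i - 1))) = 1}"
      using ij nth_prime_mult_dvd_iff[of i j]
      unfolding gcd_primorial_eq_1_iff multiples_def I_def D_def by auto
    then show "(\<Sum>a\<in>I. T i j a) = G i j"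
      using \<open>finite I\<close> by (simp add: T_def G_def sum.If_cases Int_def)
  qed
  also have "\<dots> = (\<Sum>j=2..k. G 1 j) + (\<Sum>i=2..k. \<Sum>j=i+1..k. G i j)"
    using assms(1) by (simp add: sum.atLeast_Suc_atMost numeral_2_eq_2)
  \<comment> \<open>For \<open>i = k\<close> the inner range is empty.\<close>
  also have "(\<Sum>i=2..k. \<Sum>j=i+1..k. G i j) = (\<Sum>i=2..k-1. \<Sum>j=i+1..k. G i j)"
    by (intro sum.mono_neutral_right) auto
  also have "\<dots> = (\<Sum>i=2..k - 1. \<Sum>j=i + 1..k.
      phi (c (nth_prime i * nth_prime j)) (F b m (nth_prime i * nth_prime j)) (i - 1))"
    unfolding G_def
    by (intro sum.cong refl phi_admissible_shift[symmetric] assms(2)) auto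
  \<comment> \<open>\<open>primorial 0\<close> is the empty product 1, so every multiple of
    \<open>2 * nth_prime j\<close> is counted.\<close>
  also have "(\<Sum>j=2..k. G 1 j) = (\<Sum>j=2..k. F b m (2 * nth_prime j))"
    using nth_prime_1 by (simp add: G_def F_def primorial_def)
  finally show ?thesis
    by (simp only: I_def)
qed

end
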